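(* Let $n\ge 1$ and let $t_1,\ldots,t_n$ be distinct positive real numbers. Let $C\in\mathbb{R}^{n\times n}$ be the (nonsingular) matrix with $C_{ij}=t_i^{\,j}$ for $i,j=1,\ldots,n$, let $D:=C^{-1}$, let $d_i^T$ be the $i$th row of $D$, and set $\ell_i(x):=d_i^Tx$ for $x\in\mathbb{R}^n$, $i=1,\ldots,n$. Define $$\mathcal X_n:=\bigl\{x\in\{0,1\}^n\ \big|\ \ell_i(x)^2-\ell_{i+1}(x)=0\ (i=1,\ldots,n-1),\ \ell_n(x)^2=0\bigr\}$$ and let $$\mathcal S_n:=\bigl\{Y\in\mathbb{S}^{n+1}_+\ \big|\ Y_{00}=1,\ Y_{kk}-Y_{0k}=0\ (k=1,\ldots,n),\ \langle G_i,Y\rangle=0\ (i=1,\ldots,n)\bigr\}$$ be its Shor relaxation, where, with $\tilde d_i:=\binom{0}{d_i}\in\mathbb{R}^{n+1}$, $$G_i:=\tilde d_i\tilde d_i^T-\tfrac12\bigl(e_0\tilde d_{i+1}^T+\tilde d_{i+1}e_0^T\bigr)\quad(i=1,\ldots,n-1),\qquad G_n:=\tilde d_n\tilde d_n^T.$$ Then $\mathcal X_n=\{0\}$, and $\mathcal S_n$ has singularity degree $n$.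
   Context: $\mathbb{S}^k$ is the space of real symmetric $k\times k$ matrices with inner product $\langle U,V\rangle=\operatorname{trace}(UV)$, and $\mathbb{S}^k_+$ is its cone of positive semidefinite matrices. Coordinates of $\mathbb{R}^{n+1}$ and rows and columns of matrices in $\mathbb{S}^{n+1}$ are indexed by $0,1,\ldots,n$, and $e_0,\ldots,e_n$ are the corresponding standard unit vectors. Singularity degree. Let $K$ be a closed, full-dimensional, self-dual convex cone in a finite-dimensional inner-product space (here $K=\mathbb{S}^{n+1}_+$), and let $\mathcal F=\{z\in K\mid \mathcal A(z)=g\}$ be nonempty, where $\mathcal A$ is a linear map into some $\mathbb{R}^m$ with adjoint $\mathcal A^*$ and $g\in\mathbb{R}^m$. The minimal face of $\mathcal F$ is the smallest face of $K$ containing $\mathcal F$. Given a face $F$ of $K$ with $\mathcal F\subseteq F$, a facial-reduction step at $F$ consists of choosing $y\in\mathbb{R}^m$ with $g^Ty=0$ such that $w:=\mathcal A^*(y)$ satisfies $\langle w,z\rangle\ge 0$ for all $z\in F$ and $\langle w,z\rangle\neq 0$ for some $z\in F$, and replacing $F$ by the strictly smaller face $F\cap w^\perp$, which still contains $\mathcal F$. (For $F=K$ this says $\mathcal A^*(y)\in K\setminus\{0\}$ and $g^Ty=0$.) The singularity degree $\operatorname{sd}(\mathcal F)$ is the smallest number of successive facial-reduction steps, starting from $F=K$, needed to reach the minimal face. It is $0$ exactly when $\mathcal F\cap\operatorname{ri}(K)\neq\emptyset$. For $\mathcal S_n$, the system $\mathcal A(z)=g$ consists of the $2n+1$ scalar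 linear equations on $Y$ displayed in the definition of $\mathcal S_n$. *)

theory Defs
  imports
    "HOL-Library.Extended_Nat"
    "Jordan_Normal_Form.Gauss_Jordan_Elimination"
begin

text \<open>Matrices and vectors of \<open>Jordan_Normal_Form\<close> are indexed from 0.  This is the indexing
  of \<open>\<real>\<^sup>n\<^sup>+\<^sup>1\<close> and of its symmetric matrices used in the mathematics; for \<open>\<real>\<^sup>n\<close> the mathematics
  starts at 1, so that the coordinate \<open>x\<^sub>k\<close> is \<open>x $ (k - 1)\<close>.\<close>

section \<open>Facial reduction over the positive semidefinite cone\<close>

definition sym_mats :: "nat \<Rightarrow> real mat set" where
  "sym_mats k = {U \<in> carrier_mat k k. transpose_mat U = U}"

definition mat_trace :: "real mat \<Rightarrow> real" where
  "mat_trace U = (\<Sum>i<dim_row U. U $$ (i, i))"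

definition mat_inner :: "real mat \<Rightarrow> real mat \<Rightarrow> real" where
  "mat_inner U V = mat_trace (U * V)"

definition psd_cone :: "nat \<Rightarrow> real mat set" where
  "psd_cone k = {U \<in> sym_mats k. \<forall>v \<in> carrier_vec k. v \<bullet> (U *\<^sub>v v) \<ge> 0}"

text \<open>Since \<open>real mat\<close> is not a real vector space as a type, convexity and faces are restated
  here.  The definition of a face follows \<open>face_of\<close> of HOL-Analysis.\<close>

definition convex_mats :: "real mat set \<Rightarrow> bool" where
  "convex_mats F \<longleftrightarrow>
     (\<forall>a\<in>F. \<forall>b\<in>F. \<forall>u. 0 \<le> u \<and> u \<le> 1 \<longrightarrow> (1 - u) \<cdot>\<^sub>m a + u \<cdot>\<^sub>m b \<in> F)"

definition is_face :: "real mat set \<Rightarrow> real mat set \<Rightarrow> bool" where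
  "is_face F K \<longleftrightarrow> F \<subseteq> K \<and> convex_mats F \<and>
     (\<forall>a\<in>K. \<forall>b\<in>K. \<forall>u. 0 < u \<and> u < 1 \<and> (1 - u) \<cdot>\<^sub>m a + u \<cdot>\<^sub>m b \<in> F \<longrightarrow> a \<in> F \<and> b \<in> F)"

text \<open>In the following, \<open>A\<close> is a linear map from \<open>sym_mats k\<close> to \<open>carrier_vec m\<close> and \<open>g\<close> is in
  \<open>carrier_vec m\<close>.\<close>

definition feasible_set :: "nat \<Rightarrow> (real mat \<Rightarrow> real vec) \<Rightarrow> real vec \<Rightarrow> real mat set" where
  "feasible_set k A g = {Z \<in> psd_cone k. A Z = g}"

definition minimal_face :: "nat \<Rightarrow> (real mat \<Rightarrow> real vec) \<Rightarrow> real vec \<Rightarrow> real mat set" where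
  "minimal_face k A g = \<Inter> {F. is_face F (psd_cone k) \<and> feasible_set k A g \<subseteq> F}"

text \<open>By nondegeneracy of the inner product there is exactly one such \<open>W\<close> when \<open>A\<close> is linear.\<close>

definition adjoint_map :: "nat \<Rightarrow> (real mat \<Rightarrow> real vec) \<Rightarrow> real vec \<Rightarrow> real mat" where
  "adjoint_map k A y = (THE W. W \<in> sym_mats k \<and> (\<forall>Z \<in> sym_mats k. mat_inner W Z = y \<bullet> A Z))"

definition facial_reduction_step ::
  "nat \<Rightarrow> nat \<Rightarrow> (real mat \<Rightarrow> real vec) \<Rightarrow> real vec \<Rightarrow> real mat set \<Rightarrow> real mat set \<Rightarrow> bool" where
  "facial_reduction_step k m A g F F' \<longleftrightarrow>
     is_face F (psd_cone k) \<and> feasible_set k A g \<subseteq> F \<and>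
     (\<exists>y \<in> carrier_vec m. g \<bullet> y = 0 \<and>
        (\<forall>Z\<in>F. mat_inner (adjoint_map k A y) Z \<ge> 0) \<and>
        (\<exists>Z\<in>F. mat_inner (adjoint_map k A y) Z \<noteq> 0) \<and>
        F' = {Z\<in>F. mat_inner (adjoint_map k A y) Z = 0})"

text \<open>The value is in \<open>enat\<close>: it would be \<open>\<infinity>\<close> if no sequence of steps reached the minimal face.\<close>

definition singularity_degree ::
  "nat \<Rightarrow> nat \<Rightarrow> (real mat \<Rightarrow> real vec) \<Rightarrow> real vec \<Rightarrow> enat" where
  "singularity_degree k m A g =
     Inf {enat s | s. (facial_reduction_step k m A g ^^ s) (psd_cone k) (minimal_face k A g)}"

section \<open>The binary quadratic system and its Shor relaxation\<close>

text \<open>\<open>d\<^sub>i\<close> is the \<open>i\<close>th row of \<open>D\<close>, for \<open>i = 1, \<dots>, n\<close>.\<close>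

definition d_row :: "real mat \<Rightarrow> nat \<Rightarrow> real vec" where
  "d_row D i = row D (i - 1)"

definition ell :: "real mat \<Rightarrow> nat \<Rightarrow> real vec \<Rightarrow> real" where
  "ell D i x = d_row D i \<bullet> x"

definition X_set :: "nat \<Rightarrow> real mat \<Rightarrow> real vec set" where
  "X_set n D = {x \<in> carrier_vec n.
     (\<forall>k<n. x $ k \<in> {0, 1}) \<and>
     (\<forall>i\<in>{1..<n}. (ell D i x)\<^sup>2 - ell D (i + 1) x = 0) \<and>
     (ell D n x)\<^sup>2 = 0}"

definition outer :: "real vec \<Rightarrow> real vec \<Rightarrow> real mat" where
  "outer u v = mat (dim_vec u) (dim_vec v) (\<lambda>(i, j). u $ i * v $ j)"

definition d_tilde :: "real mat \<Rightarrow> nat \<Rightarrow> real vec" where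
  "d_tilde D i = vCons 0 (d_row D i)"

definition G :: "nat \<Rightarrow> real mat \<Rightarrow> nat \<Rightarrow> real mat" where
  "G n D i =
     (if i < n
      then outer (d_tilde D i) (d_tilde D i)
           - (1 / 2) \<cdot>\<^sub>m (outer (unit_vec (n + 1) 0) (d_tilde D (i + 1))
                         + outer (d_tilde D (i + 1)) (unit_vec (n + 1) 0))
      else outer (d_tilde D n) (d_tilde D n))"

definition S_set :: "nat \<Rightarrow> real mat \<Rightarrow> real mat set" where
  "S_set n D = {Y \<in> psd_cone (n + 1).
     Y $$ (0, 0) = 1 \<and>
     (\<forall>k\<in>{1..n}. Y $$ (k, k) - Y $$ (0, k) = 0) \<and>
     (\<forall>i\<in>{1..n}. mat_inner (G n D i) Y = 0)}"

text \<open>The left-hand sides of the \<open>2 n + 1\<close> equations of \<open>S_set\<close>, in the order in which they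
  appear there, and their right-hand sides \<open>(1, 0, \<dots>, 0)\<close>.\<close>

definition shor_map :: "nat \<Rightarrow> real mat \<Rightarrow> real mat \<Rightarrow> real vec" where
  "shor_map n D Y = vec (2 * n + 1) (\<lambda>j.
     if j = 0 then Y $$ (0, 0)
     else if j \<le> n then Y $$ (j, j) - Y $$ (0, j)
     else mat_inner (G n D (j - n)) Y)"

definition shor_rhs :: "nat \<Rightarrow> real vec" where
  "shor_rhs n = unit_vec (2 * n + 1) 0"

end

theory Submission
  imports Defs "Jordan_Normal_Form.Determinant"
begin

text \<open>Work in the coordinates \<open>q Y i j = d\<^sub>i\<^sup>T Y d\<^sub>j\<close> with respect to the basis \<open>d\<^sub>0 = e\<^sub>0\<close>, \<open>d\<^sub>i = d_tilde D i\<close>,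
  in which \<open>e\<^sub>k = \<Sum>\<^sub>i t\<^sub>k\<^sup>i d\<^sub>i\<close>.  Let \<open>face m\<close> be the face of the semidefinite cone on which
  \<open>q Y i i = 0\<close> for all \<open>i > m\<close>.  On \<open>face m\<close>, exposing by \<open>G\<^sub>m\<close> gives \<open>face (m - 1)\<close>, so \<open>n\<close> steps reach
  \<open>face 0\<close>, the ray of \<open>e\<^sub>0e\<^sub>0\<^sup>T\<close>, which is the minimal face.

  Conversely, an admissible exposing functional combines the equations \<open>Y\<^sub>k\<^sub>k = Y\<^sub>0\<^sub>k\<close> with weights
  \<open>a\<^sub>k\<close> and \<open>\<langle>G\<^sub>i, Y\<rangle> = 0\<close> with weights \<open>b\<^sub>i\<close>.  In \<open>q\<close>-coordinates its \<open>(0, 0)\<close> entry vanishes and its other entries are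
  governed by the moments \<open>\<mu>\<^sub>p = \<Sum>\<^sub>k a\<^sub>k t\<^sub>k\<^sup>p\<close>.  If it is nonnegative on \<open>face m\<close>, then row \<open>0\<close> vanishes, so
  \<open>\<mu>\<^sub>1 = 0\<close> and \<open>b\<^sub>i = - \<mu>\<^sub>i\<^sub>+\<^sub>1\<close> for \<open>i < m\<close>.  The diagonal entries \<open>\<mu>\<^sub>2\<^sub>i - \<mu>\<^sub>i\<^sub>+\<^sub>1\<close>, \<open>i < m\<close>, then vanish
  one after the other, because each is a difference of entries in rows already known to be zero.  Only the \<open>(m, m)\<close> entry
  can survive, hence a step never gets from a set containing \<open>face m\<close> to one that does not contain \<open>face (m - 1)\<close>.\<close>

section \<open>Bilinear forms and the semidefinite cone\<close>

text \<open>Vectors are functions on indices, so expansions in a basis are ordinary sums; only the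
  values at \<open>0..n\<close> matter.\<close>

definition bil :: "nat \<Rightarrow> real mat \<Rightarrow> (nat \<Rightarrow> real) \<Rightarrow> (nat \<Rightarrow> real) \<Rightarrow> real" where
  "bil n Y x z = (\<Sum>k\<le>n. \<Sum>l\<le>n. x k * Y $$ (k, l) * z l)"

lemma sym_mats_carrier: "Y \<in> sym_mats k \<Longrightarrow> Y \<in> carrier_mat k k"
  by (simp add: sym_mats_def)

lemma sym_mats_index:
  assumes "Y \<in> sym_mats k" "i < k" "j < k"
  shows "Y $$ (i, j) = Y $$ (j, i)"
proof -
  have "Y = transpose_mat Y" "Y \<in> carrier_mat k k"
    using assms by (auto simp: sym_mats_def)
  then show ?thesis
    using assms index_transpose_mat(1)[of i Y j] by auto
qed

lemma sym_matsI:
  assumes "Y \<in> carrier_mat k k" "\<And>i j. i < k \<Longrightarrow> j < k \<Longrightarrow> Y $$ (i, j) = Y $$ (j, i)"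
  shows "Y \<in> sym_mats k"
  using assms by (auto simp: sym_mats_def intro!: eq_matI)

lemma psd_cone_sym: "Y \<in> psd_cone k \<Longrightarrow> Y \<in> sym_mats k"
  by (simp add: psd_cone_def)

lemma bil_sym: "Y \<in> sym_mats (Suc n) \<Longrightarrow> bil n Y x z = bil n Y z x"
  unfolding bil_def
  by (subst sum.swap) (auto intro!: sum.cong simp: sym_mats_index mult_ac)

lemma bil_add_left: "bil n Y (\<lambda>k. x k + y k) z = bil n Y x z + bil n Y y z"
  by (simp add: bil_def algebra_simps sum.distrib)

lemma bil_add_right: "bil n Y x (\<lambda>k. y k + z k) = bil n Y x y + bil n Y x z"
  by (simp add: bil_def algebra_simps sum.distrib)

lemma bil_scale_left: "bil n Y (\<lambda>k. s * x k) z = s * bil n Y x z"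
  by (simp add: bil_def sum_distrib_left mult_ac)

lemma bil_scale_right: "bil n Y x (\<lambda>k. s * z k) = s * bil n Y x z"
  by (simp add: bil_def sum_distrib_left mult_ac)

lemma bil_sum_left: "bil n Y (\<lambda>k. \<Sum>i\<in>A. x i k) z = (\<Sum>i\<in>A. bil n Y (x i) z)"
proof -
  have "bil n Y (\<lambda>k. \<Sum>i\<in>A. x i k) z = (\<Sum>k\<le>n. \<Sum>l\<le>n. \<Sum>i\<in>A. x i k * Y $$ (k, l) * z l)"
    by (simp add: bil_def sum_distrib_right)
  also have "\<dots> = (\<Sum>k\<le>n. \<Sum>i\<in>A. \<Sum>l\<le>n. x i k * Y $$ (k, l) * z l)"
    by (intro sum.cong refl sum.swap)
  also have "\<dots> = (\<Sum>i\<in>A. bil n Y (x i) z)"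
    unfolding bil_def by (rule sum.swap)
  finally show ?thesis .
qed

lemma bil_sum_right: "bil n Y x (\<lambda>l. \<Sum>j\<in>A. z j l) = (\<Sum>j\<in>A. bil n Y x (z j))"
proof -
  have "bil n Y x (\<lambda>l. \<Sum>j\<in>A. z j l) = (\<Sum>k\<le>n. \<Sum>l\<le>n. \<Sum>j\<in>A. x k * Y $$ (k, l) * z j l)"
    by (simp add: bil_def sum_distrib_left)
  also have "\<dots> = (\<Sum>k\<le>n. \<Sum>j\<in>A. \<Sum>l\<le>n. x k * Y $$ (k, l) * z j l)"
    by (intro sum.cong refl sum.swap)
  also have "\<dots> = (\<Sum>j\<in>A. bil n Y x (z j))"
    unfolding bil_def by (rule sum.swap)
  finally show ?thesis .
qed

lemma bil_cong:
  "(\<And>k. k \<le> n \<Longrightarrow> x k = x' k) \<Longrightarrow> (\<And>k. k \<le> n \<Longrightarrow> z k = z' k) \<Longrightarrow> bil n Y x z = bil n Y x' z'"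
  by (simp add: bil_def)

lemma bil_unit:
  assumes "p \<le> n" "q \<le> n"
  shows "bil n Y (\<lambda>k. of_bool (k = p)) (\<lambda>l. of_bool (l = q)) = Y $$ (p, q)"
proof -
  have "bil n Y (\<lambda>k. of_bool (k = p)) (\<lambda>l. of_bool (l = q))
      = (\<Sum>k\<le>n. \<Sum>l\<le>n. if l = q then if k = p then Y $$ (k, l) else 0 else 0)"
    unfolding bil_def by (intro sum.cong) auto
  with assms show ?thesis by simp
qed

lemma bil_convex:
  assumes "Y \<in> carrier_mat (Suc n) (Suc n)" "Z \<in> carrier_mat (Suc n) (Suc n)"
  shows "bil n (r \<cdot>\<^sub>m Y + s \<cdot>\<^sub>m Z) x z = r * bil n Y x z + s * bil n Z x z"
  using assms by (simp add: bil_def algebra_simps sum.distrib sum_distrib_left)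

lemma bil_smult:
  assumes "Y \<in> carrier_mat (Suc n) (Suc n)"
  shows "bil n (r \<cdot>\<^sub>m Y) x z = r * bil n Y x z"
  using assms by (simp add: bil_def algebra_simps sum_distrib_left)

lemma quadratic_eq_bil:
  assumes "Y \<in> carrier_mat (Suc n) (Suc n)" "v \<in> carrier_vec (Suc n)"
  shows "v \<bullet> (Y *\<^sub>v v) = bil n Y (($) v) (($) v)"
  using assms
  by (auto simp: bil_def scalar_prod_def sum_distrib_left mult_ac lessThan_Suc_atMost
      simp flip: lessThan_atLeast0 intro!: sum.cong)

lemma psd_cone_iff:
  "Y \<in> psd_cone (Suc n) \<longleftrightarrow> Y \<in> sym_mats (Suc n) \<and> (\<forall>x. bil n Y x x \<ge> 0)"
proof (intro iffI conjI allI)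
  assume Y: "Y \<in> psd_cone (Suc n)"
  then show "Y \<in> sym_mats (Suc n)"
    by (rule psd_cone_sym)
  then have "Y \<in> carrier_mat (Suc n) (Suc n)"
    by (rule sym_mats_carrier)
  then have "vec (Suc n) x \<bullet> (Y *\<^sub>v vec (Suc n) x) = bil n Y x x" for x
    by (subst quadratic_eq_bil) (auto intro: bil_cong)
  with Y show "bil n Y x x \<ge> 0" for x
    unfolding psd_cone_def by (metis (mono_tags, lifting) mem_Collect_eq vec_carrier)
next
  assume Y: "Y \<in> sym_mats (Suc n) \<and> (\<forall>x. bil n Y x x \<ge> 0)"
  then show "Y \<in> psd_cone (Suc n)"
    by (auto simp: psd_cone_def quadratic_eq_bil[OF sym_mats_carrier])
qed

lemma quadratic_nonneg_zero:
  fixes a b c :: real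
  assumes "\<And>s. a + s * b + s\<^sup>2 * c \<ge> 0" "c = 0"
  shows "b = 0"
proof (rule ccontr)
  assume "b \<noteq> 0"
  \<comment> \<open>At this \<open>s\<close> the affine function \<open>a + s * b\<close> equals
    -1.\<close>
  then show False
    using assms(1)[of "- (a + 1) / b"] assms(2) by simp
qed

text \<open>Expand the form at \<open>z + s x\<close>: without a quadratic term, nonnegativity for
  all \<open>s\<close> forces the linear coefficient \<open>2 * bil n Y x z\<close> to
  vanish.\<close>

lemma psd_isotropic:
  assumes Y: "Y \<in> psd_cone (Suc n)" and x: "bil n Y x x = 0"
  shows "bil n Y x z = 0" "bil n Y z x = 0"
proof -
  have "bil n Y z z + s * (2 * bil n Y x z) + s\<^sup>2 * bil n Y x x \<ge> 0" for s
  proof -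
    have "bil n Y (\<lambda>k. z k + s * x k) (\<lambda>k. z k + s * x k) \<ge> 0"
      using Y by (simp add: psd_cone_iff)
    moreover have "bil n Y (\<lambda>k. z k + s * x k) (\<lambda>k. z k + s * x k)
        = bil n Y z z + s * (2 * bil n Y x z) + s\<^sup>2 * bil n Y x x"
      using bil_sym[OF psd_cone_sym[OF Y], of z x]
      by (simp add: bil_add_left bil_add_right bil_scale_left bil_scale_right
          power2_eq_square algebra_simps)
    ultimately show ?thesis by simp
  qed
  from quadratic_nonneg_zero[OF this x] show "bil n Y x z = 0" by simp
  then show "bil n Y z x = 0"
    using bil_sym[OF psd_cone_sym[OF Y]] by simp
qed

lemma psd_cone_convex: "convex_mats (psd_cone (Suc n))"
proof -
  have "(1 - u) \<cdot>\<^sub>m a + u \<cdot>\<^sub>m b \<in> psd_cone (Suc n)"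
    if a: "a \<in> psd_cone (Suc n)" and b: "b \<in> psd_cone (Suc n)" and u: "0 \<le> u" "u \<le> 1" for a b u
  proof -
    note ab = psd_cone_sym[OF a] psd_cone_sym[OF b]
    note car = ab[THEN sym_mats_carrier]
    have "(1 - u) \<cdot>\<^sub>m a + u \<cdot>\<^sub>m b \<in> sym_mats (Suc n)"
    proof (rule sym_matsI)
      fix i j assume "i < Suc n" "j < Suc n"
      then show "((1 - u) \<cdot>\<^sub>m a + u \<cdot>\<^sub>m b) $$ (i, j) = ((1 - u) \<cdot>\<^sub>m a + u \<cdot>\<^sub>m b) $$ (j, i)"
        using car ab[THEN sym_mats_index, of i j] by simp
    qed (use car in auto)
    then show ?thesis
      using a b u by (simp add: psd_cone_iff bil_convex[OF car])
  qed
  then show ?thesis by (simp add: convex_mats_def)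
qed

section \<open>Inner products and adjoints\<close>

lemma mat_inner_eq_sum:
  assumes "U \<in> carrier_mat (Suc n) (Suc n)" "V \<in> carrier_mat (Suc n) (Suc n)"
  shows "mat_inner U V = (\<Sum>i\<le>n. \<Sum>j\<le>n. U $$ (i, j) * V $$ (j, i))"
  using assms
  by (auto simp: mat_inner_def mat_trace_def scalar_prod_def lessThan_Suc_atMost
      simp flip: lessThan_atLeast0 intro!: sum.cong)

text \<open>Testing with \<open>W - W'\<close> itself yields a vanishing sum of squares. This gives
  the uniqueness behind the \<open>THE\<close> in \<open>adjoint_map\<close>.\<close>

lemma sym_mats_eqI:
  assumes W: "W \<in> sym_mats (Suc n)" "W' \<in> sym_mats (Suc n)"
    and eq: "\<And>Z. Z \<in> sym_mats (Suc n) \<Longrightarrow> mat_inner W Z = mat_inner W' Z"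
  shows "W = W'"
proof -
  note car = W[THEN sym_mats_carrier]
  define Z where "Z = W - W'"
  have Z: "Z \<in> sym_mats (Suc n)"
  proof (rule sym_matsI)
    fix i j assume "i < Suc n" "j < Suc n"
    then show "Z $$ (i, j) = Z $$ (j, i)"
      using car W[THEN sym_mats_index, of i j] by (simp add: Z_def)
  qed (use car in \<open>auto simp: Z_def\<close>)
  have "(\<Sum>i\<le>n. \<Sum>j\<le>n. (W $$ (i, j) - W' $$ (i, j))\<^sup>2) = mat_inner W Z - mat_inner W' Z"
  proof -
    have "W $$ (i, j) * Z $$ (j, i) - W' $$ (i, j) * Z $$ (j, i) = (W $$ (i, j) - W' $$ (i, j))\<^sup>2"
      if "i \<le> n" "j \<le> n" for i j
    proof -
      have "Z $$ (j, i) = W $$ (i, j) - W' $$ (i, j)"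
        using that car sym_mats_index[OF Z, of i j] by (simp add: Z_def)
      then show ?thesis
        by (simp only: power2_eq_square) (simp only: algebra_simps)
    qed
    then show ?thesis
      by (simp add: mat_inner_eq_sum[OF _ sym_mats_carrier[OF Z]] car flip: sum_subtractf)
  qed
  also have "\<dots> = 0" using eq[OF Z] by simp
  finally have "\<forall>i\<le>n. \<forall>j\<le>n. (W $$ (i, j) - W' $$ (i, j))\<^sup>2 = 0"
    by (simp add: sum_nonneg_eq_0_iff sum_nonneg)
  then show ?thesis
    using car by (auto intro!: eq_matI)
qed

text \<open>The combination of the representing matrices \<open>B j\<close> with weights
  \<open>y $ j\<close> has the defining property of the adjoint, and \<open>sym_mats_eqI\<close>
  makes it the only one.\<close>

lemma adjoint_map_inner:
  assumes A: "\<And>Z. Z \<in> sym_mats (Suc n) \<Longrightarrow> A Z = vec m (\<lambda>j. mat_inner (B j) Z)"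
    and B: "\<And>j. j < m \<Longrightarrow> B j \<in> sym_mats (Suc n)"
    and y: "y \<in> carrier_vec m" and Z: "Z \<in> sym_mats (Suc n)"
  shows "mat_inner (adjoint_map (Suc n) A y) Z = y \<bullet> A Z"
proof -
  let ?P = "\<lambda>W. W \<in> sym_mats (Suc n) \<and> (\<forall>Z\<in>sym_mats (Suc n). mat_inner W Z = y \<bullet> A Z)"
  define W where "W = mat (Suc n) (Suc n) (\<lambda>(p, q). \<Sum>j<m. y $ j * B j $$ (p, q))"
  have Wc: "W \<in> carrier_mat (Suc n) (Suc n)" by (simp add: W_def)
  have "W \<in> sym_mats (Suc n)"
    using sym_mats_index[OF B] by (intro sym_matsI Wc) (simp add: W_def)
  moreover have "mat_inner W Z = y \<bullet> A Z" if Z: "Z \<in> sym_mats (Suc n)" for Z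
  proof -
    have "mat_inner W Z = (\<Sum>p\<le>n. \<Sum>q\<le>n. \<Sum>j<m. y $ j * (B j $$ (p, q) * Z $$ (q, p)))"
      unfolding mat_inner_eq_sum[OF Wc sym_mats_carrier[OF Z]]
      by (simp add: W_def sum_distrib_right mult.assoc)
    also have "\<dots> = (\<Sum>p\<le>n. \<Sum>j<m. \<Sum>q\<le>n. y $ j * (B j $$ (p, q) * Z $$ (q, p)))"
      by (intro sum.cong refl sum.swap)
    also have "\<dots> = (\<Sum>j<m. \<Sum>p\<le>n. \<Sum>q\<le>n. y $ j * (B j $$ (p, q) * Z $$ (q, p)))"
      by (rule sum.swap)
    also have "\<dots> = (\<Sum>j<m. y $ j * mat_inner (B j) Z)"
      by (intro sum.cong refl)
        (simp add: mat_inner_eq_sum[OF sym_mats_carrier[OF B] sym_mats_carrier[OF Z]] sum_distrib_left)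
    also have "\<dots> = y \<bullet> A Z"
      by (simp add: A[OF Z] scalar_prod_def lessThan_atLeast0)
    finally show ?thesis .
  qed
  ultimately have P: "?P W" by blast
  have "W' = W" if "?P W'" for W'
    using that P by (intro sym_mats_eqI) auto
  with P have "?P (adjoint_map (Suc n) A y)"
    unfolding adjoint_map_def by (rule theI)
  with Z show ?thesis by blast
qed

section \<open>Coordinates adapted to the Shor relaxation\<close>

locale shor_system =
  fixes n :: nat and t :: "nat \<Rightarrow> real" and D :: "real mat"
  assumes n_pos: "n \<ge> 1"
    and D_carrier: "D \<in> carrier_mat n n"
    and C_D: "mat n n (\<lambda>(i, j). t (i + 1) ^ (j + 1)) * D = 1\<^sub>m n"
    and D_C: "D * mat n n (\<lambda>(i, j). t (i + 1) ^ (j + 1)) = 1\<^sub>m n"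
begin

text \<open>The row \<open>M i\<close> is \<open>e\<^sub>0\<close> for \<open>i = 0\<close> and the vector \<open>d_tilde D i\<close> otherwise; \<open>P\<close> is the inverse of \<open>M\<close>.\<close>

definition M :: "nat \<Rightarrow> nat \<Rightarrow> real" where
  "M i k = (if i = 0 \<or> k = 0 then of_bool (i = k) else D $$ (i - 1, k - 1))"

definition P :: "nat \<Rightarrow> nat \<Rightarrow> real" where
  "P k i = (if k = 0 \<or> i = 0 then of_bool (k = i) else t k ^ i)"

definition q :: "real mat \<Rightarrow> nat \<Rightarrow> nat \<Rightarrow> real" where
  "q Y i j = bil n Y (M i) (M j)"

lemma P_M:
  assumes "k \<le> n" "l \<le> n"
  shows "(\<Sum>i\<le>n. P k i * M i l) = of_bool (k = l)"
proof (cases "k = 0 \<or> l = 0")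
  case True
  then show ?thesis
    by (auto simp: sum.atMost_shift P_def M_def)
next
  case False
  then obtain k' l' where kl: "k = Suc k'" "l = Suc l'" "k' < n" "l' < n"
    using assms by (metis Suc_le_eq not0_implies_Suc)
  have "(\<Sum>i\<le>n. P k i * M i l) = (\<Sum>i<n. t (Suc k') ^ Suc i * D $$ (i, l'))"
    using kl by (simp add: sum.atMost_shift P_def M_def)
  also have "\<dots> = (mat n n (\<lambda>(i, j). t (i + 1) ^ (j + 1)) * D) $$ (k', l')"
    using kl D_carrier by (simp add: scalar_prod_def lessThan_atLeast0)
  also have "\<dots> = of_bool (k = l)"
    unfolding C_D using kl by simp
  finally show ?thesis .
qed

lemma M_P:
  assumes "i \<le> n" "j \<le> n"
  shows "(\<Sum>k\<le>n. M i k * P k j) = of_bool (i = j)"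
proof (cases "i = 0 \<or> j = 0")
  case True
  then show ?thesis
    by (auto simp: sum.atMost_shift P_def M_def)
next
  case False
  then obtain i' j' where ij: "i = Suc i'" "j = Suc j'" "i' < n" "j' < n"
    using assms by (metis Suc_le_eq not0_implies_Suc)
  have "(\<Sum>k\<le>n. M i k * P k j) = (\<Sum>k<n. D $$ (i', k) * t (Suc k) ^ Suc j')"
    using ij by (simp add: sum.atMost_shift P_def M_def)
  also have "\<dots> = (D * mat n n (\<lambda>(i, j). t (i + 1) ^ (j + 1))) $$ (i', j')"
    using ij D_carrier by (simp add: scalar_prod_def lessThan_atLeast0)
  also have "\<dots> = of_bool (i = j)"
    unfolding D_C using ij by simp
  finally show ?thesis .
qed

text \<open>By \<open>P_M\<close>, the \<open>k\<close>th unit vector is the combination of the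
  \<open>M i\<close> with coefficients \<open>P k i\<close>; both arguments of the form are expanded
  this way.\<close>

lemma entry_eq_sum_q:
  assumes "k \<le> n" "l \<le> n"
  shows "Y $$ (k, l) = (\<Sum>i\<le>n. \<Sum>j\<le>n. P k i * P l j * q Y i j)"
proof -
  have "Y $$ (k, l) = bil n Y (\<lambda>k'. of_bool (k' = k)) (\<lambda>l'. of_bool (l' = l))"
    using assms by (simp add: bil_unit)
  also have "\<dots> = bil n Y (\<lambda>k'. \<Sum>i\<le>n. P k i * M i k') (\<lambda>l'. \<Sum>j\<le>n. P l j * M j l')"
    using assms by (intro bil_cong) (auto simp: P_M)
  also have "\<dots> = (\<Sum>i\<le>n. \<Sum>j\<le>n. P k i * P l j * q Y i j)"
    by (simp add: bil_sum_left bil_sum_right bil_scale_left bil_scale_right q_def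
        sum_distrib_left mult.assoc)
  finally show ?thesis .
qed

lemma mat_eqI_q:
  assumes "Y \<in> carrier_mat (Suc n) (Suc n)" "Z \<in> carrier_mat (Suc n) (Suc n)"
    and "\<And>i j. i \<le> n \<Longrightarrow> j \<le> n \<Longrightarrow> q Y i j = q Z i j"
  shows "Y = Z"
  using assms by (intro eq_matI) (auto simp: entry_eq_sum_q[of _ _ Y] entry_eq_sum_q[of _ _ Z])

lemma q_sym: "Y \<in> sym_mats (Suc n) \<Longrightarrow> q Y i j = q Y j i"
  unfolding q_def by (rule bil_sym)

lemma q_smult: "Y \<in> carrier_mat (Suc n) (Suc n) \<Longrightarrow> q (s \<cdot>\<^sub>m Y) i j = s * q Y i j"
  by (simp add: q_def bil_smult)

lemma q_nonneg: "Y \<in> psd_cone (Suc n) \<Longrightarrow> q Y i i \<ge> 0"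
  by (simp add: q_def psd_cone_iff)

lemma d_tilde_index:
  "\<lbrakk>1 \<le> i; i \<le> n; k \<le> n\<rbrakk> \<Longrightarrow> d_tilde D i $ k = M i k"
  using D_carrier by (auto simp: d_tilde_def d_row_def vec_index_vCons M_def)

lemma dim_d_tilde: "dim_vec (d_tilde D i) = Suc n"
  using D_carrier by (simp add: d_tilde_def d_row_def)

lemma outer_carrier:
  "dim_vec u = Suc n \<Longrightarrow> dim_vec v = Suc n \<Longrightarrow> outer u v \<in> carrier_mat (Suc n) (Suc n)"
  by (simp add: outer_def)

lemma G_carrier: "G n D i \<in> carrier_mat (Suc n) (Suc n)"
  unfolding G_def by (auto intro!: outer_carrier minus_carrier_mat smult_carrier_mat add_carrier_mat
      simp: dim_d_tilde)

lemma outer_index: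
  "\<lbrakk>dim_vec u = Suc n; dim_vec v = Suc n; k \<le> n; l \<le> n\<rbrakk> \<Longrightarrow> outer u v $$ (k, l) = u $ k * v $ l"
  by (simp add: outer_def)

lemma G_index:
  assumes "1 \<le> i" "i \<le> n" "k \<le> n" "l \<le> n"
  shows "G n D i $$ (k, l) = M i k * M i l
    - (if i < n then 1 / 2 * (M 0 k * M (i + 1) l + M (i + 1) k * M 0 l) else 0)"
proof (cases "i < n")
  case True
  have dim: "dim_row (outer u v) = dim_vec u" "dim_col (outer u v) = dim_vec v" for u v
    by (simp_all add: outer_def)
  show ?thesis
    using True assms
    by (simp add: G_def dim outer_index dim_d_tilde d_tilde_index M_def[of 0] index_unit_vec)
next
  case False
  with assms have "i = n" by simp
  with assms show ?thesis
    by (simp add: G_def outer_index dim_d_tilde d_tilde_index)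
qed

lemma G_sym: "1 \<le> i \<Longrightarrow> i \<le> n \<Longrightarrow> G n D i \<in> sym_mats (Suc n)"
  by (intro sym_matsI G_carrier) (auto simp: G_index)

text \<open>The cross term contributes \<open>q Z 0 (i + 1)\<close> and \<open>q Z (i + 1) 0\<close>
  with weight 1/2 each, and these agree. The \<open>G\<close> equations thus form a chain:
  \<open>q Z i i = q Z 0 (i + 1)\<close> for \<open>i < n\<close>, and
  \<open>q Z n n = 0\<close>.\<close>

lemma inner_G:
  assumes Z: "Z \<in> sym_mats (Suc n)" and i: "1 \<le> i" "i \<le> n"
  shows "mat_inner (G n D i) Z = q Z i i - (if i < n then q Z 0 (i + 1) else 0)"
proof -
  have swap: "(\<Sum>k\<le>n. \<Sum>l\<le>n. x k * z l * Z $$ (l, k)) = bil n Z x z" for x z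
    using Z by (auto simp: bil_def sym_mats_index intro!: sum.cong)
  note inner = mat_inner_eq_sum[OF G_carrier sym_mats_carrier[OF Z], of i]
  show ?thesis
  proof (cases "i < n")
    case True
    then have "G n D i $$ (k, l) * Z $$ (l, k) = M i k * M i l * Z $$ (l, k)
        - (1 / 2 * (M 0 k * M (i + 1) l * Z $$ (l, k)) + 1 / 2 * (M (i + 1) k * M 0 l * Z $$ (l, k)))"
      if "k \<le> n" "l \<le> n" for k l
      using that i by (simp add: G_index field_simps)
    then have "mat_inner (G n D i) Z = q Z i i - (1 / 2 * q Z 0 (i + 1) + 1 / 2 * q Z (i + 1) 0)"
      unfolding inner q_def swap[symmetric] by (simp add: sum_subtractf sum.distrib sum_distrib_left)
    with True show ?thesis
      using q_sym[OF Z, of "i + 1" 0] by simp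
  next
    case False
    then have "mat_inner (G n D i) Z = q Z i i"
      unfolding inner q_def swap[symmetric] using i by (simp add: G_index)
    with False show ?thesis by simp
  qed
qed

text \<open>The rank-one matrix whose \<open>q\<close>-coordinates are \<open>b i * b j\<close>.\<close>

definition rank1 :: "(nat \<Rightarrow> real) \<Rightarrow> real mat" where
  "rank1 b = mat (Suc n) (Suc n) (\<lambda>(k, l). (\<Sum>j\<le>n. P k j * b j) * (\<Sum>j\<le>n. P l j * b j))"

lemma rank1_carrier: "rank1 b \<in> carrier_mat (Suc n) (Suc n)"
  by (simp add: rank1_def)

lemma bil_rank1:
  "bil n (rank1 b) x z
    = (\<Sum>k\<le>n. x k * (\<Sum>j\<le>n. P k j * b j)) * (\<Sum>l\<le>n. z l * (\<Sum>j\<le>n. P l j * b j))"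
  by (subst sum_product) (simp add: bil_def rank1_def mult_ac)

lemma rank1_psd: "rank1 b \<in> psd_cone (Suc n)"
proof -
  have "rank1 b \<in> sym_mats (Suc n)"
    by (intro sym_matsI rank1_carrier) (simp add: rank1_def)
  then show ?thesis
    by (simp add: psd_cone_iff bil_rank1)
qed

lemma q_rank1:
  assumes "i \<le> n" "j \<le> n"
  shows "q (rank1 b) i j = b i * b j"
proof -
  have "(\<Sum>k\<le>n. M i k * (\<Sum>j\<le>n. P k j * b j)) = b i" if "i \<le> n" for i
  proof -
    have "(\<Sum>k\<le>n. M i k * (\<Sum>j\<le>n. P k j * b j)) = (\<Sum>k\<le>n. \<Sum>j\<le>n. M i k * P k j * b j)"
      by (simp add: sum_distrib_left mult.assoc)
    also have "\<dots> = (\<Sum>j\<le>n. (\<Sum>k\<le>n. M i k * P k j) * b j)"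
      by (subst sum.swap) (simp add: sum_distrib_right)
    also have "\<dots> = (\<Sum>j\<le>n. if j = i then b j else 0)"
      using that by (intro sum.cong) (auto simp: M_P)
    finally show ?thesis using that by simp
  qed
  with assms show ?thesis by (simp add: q_def bil_rank1)
qed

section \<open>The chain of faces of the semidefinite cone\<close>

definition face :: "nat \<Rightarrow> real mat set" where
  "face m = {Y \<in> psd_cone (Suc n). \<forall>i. m < i \<and> i \<le> n \<longrightarrow> q Y i i = 0}"

lemma face_n: "face n = psd_cone (Suc n)"
  by (auto simp: face_def)

lemma face_psd: "Y \<in> face m \<Longrightarrow> Y \<in> psd_cone (Suc n)"
  by (simp add: face_def)

lemma face_sym: "Y \<in> face m \<Longrightarrow> Y \<in> sym_mats (Suc n)"
  by (simp add: face_def psd_cone_sym)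

text \<open>The definition of \<open>face\<close> constrains diagonal coordinates only;
  semidefiniteness clears the whole rows and columns.\<close>

lemma face_q_zero:
  assumes "Y \<in> face m" "m < i" "i \<le> n"
  shows "q Y i j = 0" "q Y j i = 0"
  using assms psd_isotropic[of Y n "M i" "M j"] by (auto simp: face_def q_def)

lemma rank1_face_iff: "rank1 b \<in> face m \<longleftrightarrow> (\<forall>i. m < i \<and> i \<le> n \<longrightarrow> b i = 0)"
  by (auto simp: face_def rank1_psd q_rank1)

text \<open>Each \<open>q Y i i\<close> is linear in \<open>Y\<close> and nonnegative on the cone,
  so it vanishes at an inner point of a segment only if it vanishes at both ends.\<close>

lemma is_face_face: "is_face (face m) (psd_cone (Suc n))"
  unfolding is_face_def
proof (intro conjI ballI allI impI)
  show "face m \<subseteq> psd_cone (Suc n)" by (auto simp: face_def)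
  have qc: "q ((1 - u) \<cdot>\<^sub>m a + u \<cdot>\<^sub>m b) i i = (1 - u) * q a i i + u * q b i i"
    if "a \<in> psd_cone (Suc n)" "b \<in> psd_cone (Suc n)" for a b u i
    using that by (simp add: q_def bil_convex psd_cone_sym sym_mats_carrier)
  show "convex_mats (face m)"
    using psd_cone_convex[of n] by (auto simp: convex_mats_def face_def qc)
  fix a b u
  assume a: "a \<in> psd_cone (Suc n)" and b: "b \<in> psd_cone (Suc n)"
    and u: "0 < u \<and> u < 1 \<and> (1 - u) \<cdot>\<^sub>m a + u \<cdot>\<^sub>m b \<in> face m"
  have "q a i i = 0 \<and> q b i i = 0" if "m < i \<and> i \<le> n" for i
  proof -
    have "(1 - u) * q a i i + u * q b i i = 0"
      using u that by (simp add: face_def flip: qc[OF a b])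
    moreover have "(1 - u) * q a i i \<ge> 0" "u * q b i i \<ge> 0"
      using u q_nonneg a b by simp_all
    ultimately have "(1 - u) * q a i i = 0" "u * q b i i = 0" by linarith+
    with u show ?thesis by simp
  qed
  then show "a \<in> face m" "b \<in> face m"
    using a b by (auto simp: face_def)
qed

section \<open>The Shor map in the adapted coordinates\<close>

text \<open>The functional \<open>Y $$ (0, j)\<close> is split evenly over the entries
  \<open>(0, j)\<close> and \<open>(j, 0)\<close> so that the representing matrix is
  symmetric.\<close>

definition shor_mat :: "nat \<Rightarrow> real mat" where
  "shor_mat j =
     (if j = 0 then mat (Suc n) (Suc n) (\<lambda>(k, l). of_bool (k = 0) * of_bool (l = 0))
      else if j \<le> n then mat (Suc n) (Suc n) (\<lambda>(k, l). of_bool (k = j) * of_bool (l = j)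
        - 1 / 2 * (of_bool (k = 0) * of_bool (l = j) + of_bool (k = j) * of_bool (l = 0)))
      else G n D (j - n))"

lemma shor_mat_sym: "j < 2 * n + 1 \<Longrightarrow> shor_mat j \<in> sym_mats (Suc n)"
  by (cases "j \<le> n") (auto simp: shor_mat_def G_sym intro!: sym_matsI[of "mat _ _ _"])

lemma inner_shor_mat:
  assumes Z: "Z \<in> sym_mats (Suc n)" and j: "j < 2 * n + 1"
  shows "mat_inner (shor_mat j) Z = shor_map n D Z $ j"
proof -
  have unit: "(\<Sum>k\<le>n. \<Sum>l\<le>n. of_bool (k = a) * of_bool (l = b) * Z $$ (l, k)) = Z $$ (a, b)"
    if "a \<le> n" "b \<le> n" for a b
  proof -
    have "Z $$ (a, b) = (\<Sum>k\<le>n. \<Sum>l\<le>n. of_bool (k = a) * Z $$ (k, l) * of_bool (l = b))"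
      using bil_unit[OF that, of Z] by (simp add: bil_def)
    also have "\<dots> = (\<Sum>k\<le>n. \<Sum>l\<le>n. of_bool (k = a) * of_bool (l = b) * Z $$ (l, k))"
      using Z by (intro sum.cong refl) (auto simp: sym_mats_index)
    finally show ?thesis by simp
  qed
  note inner = mat_inner_eq_sum[OF _ sym_mats_carrier[OF Z]]
  consider "j = 0" | "1 \<le> j" "j \<le> n" | "n < j" by linarith
  then show ?thesis
  proof cases
    case 1
    have "mat_inner (shor_mat j) Z
        = (\<Sum>k\<le>n. \<Sum>l\<le>n. of_bool (k = 0) * of_bool (l = 0) * Z $$ (l, k))"
      using 1 by (subst inner) (auto simp: shor_mat_def intro!: sum.cong)
    with 1 show ?thesis by (subst (asm) unit) (auto simp: shor_map_def)
  next
    case 2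
    have "mat_inner (shor_mat j) Z
        = (\<Sum>k\<le>n. \<Sum>l\<le>n. of_bool (k = j) * of_bool (l = j) * Z $$ (l, k)
            - (1 / 2 * (of_bool (k = 0) * of_bool (l = j) * Z $$ (l, k))
              + 1 / 2 * (of_bool (k = j) * of_bool (l = 0) * Z $$ (l, k))))"
      using 2 by (subst inner) (auto simp: shor_mat_def field_simps intro!: sum.cong)
    also have "\<dots> = Z $$ (j, j) - (1 / 2 * Z $$ (0, j) + 1 / 2 * Z $$ (j, 0))"
      using 2 unfolding sum_subtractf sum.distrib sum_distrib_left[symmetric] by (simp only: unit)
    also have "\<dots> = Z $$ (j, j) - Z $$ (0, j)"
      using 2 sym_mats_index[OF Z, of j 0] by simp
    finally show ?thesis
      using 2 by (simp add: shor_map_def)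
  next
    case 3
    with n_pos j show ?thesis by (simp add: shor_mat_def shor_map_def)
  qed
qed

lemma inner_adjoint_shor_map:
  assumes "y \<in> carrier_vec (2 * n + 1)" "Z \<in> sym_mats (Suc n)"
  shows "mat_inner (adjoint_map (Suc n) (shor_map n D) y) Z = y \<bullet> shor_map n D Z"
  using assms
  by (intro adjoint_map_inner[where B = shor_mat] shor_mat_sym)
    (auto intro!: eq_vecI simp: inner_shor_mat, simp add: shor_map_def)

text \<open>For \<open>y $ 0 = 0\<close>, the functional \<open>Z \<mapsto> y \<bullet> shor_map n D Z\<close> has in \<open>q\<close>-coordinates no
  \<open>(0, 0)\<close> entry; its \<open>(i, j)\<close> entries with \<open>i, j \<ge> 1\<close> are \<open>Hess y i j\<close>, and \<open>- lin y j\<close> collects both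
  entries \<open>(0, j)\<close> and \<open>(j, 0)\<close>.\<close>

definition moment :: "real vec \<Rightarrow> nat \<Rightarrow> real" where
  "moment y p = (\<Sum>k=1..n. y $ k * t k ^ p)"

definition Hess :: "real vec \<Rightarrow> nat \<Rightarrow> nat \<Rightarrow> real" where
  "Hess y i j = moment y (i + j) + (if i = j then y $ (n + i) else 0)"

definition lin :: "real vec \<Rightarrow> nat \<Rightarrow> real" where
  "lin y j = moment y j + (if 2 \<le> j then y $ (n + j - 1) else 0)"

lemma sum_atMost_split: "sum f {..n} = f 0 + sum f {1..n}" for f :: "nat \<Rightarrow> real"
proof -
  have "{..n} = insert 0 {1..n}" by auto
  then show ?thesis by simp
qed

text \<open>\<open>P k 0 = 0\<close> for \<open>k >= 1\<close> drops index 0, and the remaining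
  powers multiply to \<open>t k ^ (i + j)\<close>; hence the Hankel pattern of the moments in
  \<open>Hess\<close>.\<close>

lemma diag_entry:
  assumes "1 \<le> k" "k \<le> n"
  shows "Y $$ (k, k) = (\<Sum>i=1..n. \<Sum>j=1..n. t k ^ (i + j) * q Y i j)"
  using assms by (subst entry_eq_sum_q) (auto simp: sum_atMost_split P_def power_add intro!: sum.cong)

lemma row0_entry:
  assumes "1 \<le> k" "k \<le> n"
  shows "Y $$ (0, k) = (\<Sum>j=1..n. t k ^ j * q Y 0 j)"
  using assms by (subst entry_eq_sum_q) (auto simp: sum_atMost_split P_def intro!: sum.cong)

lemma functional_eq:
  assumes y: "y \<in> carrier_vec (2 * n + 1)" "y $ 0 = 0" and Z: "Z \<in> sym_mats (Suc n)"
  shows "y \<bullet> shor_map n D Z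
    = (\<Sum>i=1..n. \<Sum>j=1..n. Hess y i j * q Z i j) - (\<Sum>j=1..n. lin y j * q Z 0 j)"
proof -
  let ?S = "shor_map n D Z"
  have "{0..<2 * n + 1} = insert 0 ({1..n} \<union> {1 + n..n + n})" by auto
  then have "y \<bullet> ?S = (\<Sum>k=1..n. y $ k * ?S $ k) + (\<Sum>i=1+n..n+n. y $ i * ?S $ i)"
    using y by (simp add: scalar_prod_def shor_map_def sum.union_disjoint)
  also have "(\<Sum>i=1+n..n+n. y $ i * ?S $ i) = (\<Sum>i=1..n. y $ (i + n) * ?S $ (i + n))"
    by (rule sum.shift_bounds_cl_nat_ivl)
  also have "\<dots> = (\<Sum>i=1..n. y $ (n + i) * q Z i i)
      - (\<Sum>i=1..n. y $ (n + i) * (if i < n then q Z 0 (i + 1) else 0))"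
    unfolding sum_subtractf[symmetric]
    by (intro sum.cong refl) (auto simp: shor_map_def inner_G[OF Z] algebra_simps)
  also have "(\<Sum>i=1..n. y $ (n + i) * q Z i i)
      = (\<Sum>i=1..n. \<Sum>j=1..n. (if i = j then y $ (n + i) else 0) * q Z i j)"
    by (simp add: if_distrib[of "\<lambda>x. x * _"] cong: if_cong)
  also have "(\<Sum>i=1..n. y $ (n + i) * (if i < n then q Z 0 (i + 1) else 0))
      = (\<Sum>j=1..n. (if 2 \<le> j then y $ (n + j - 1) else 0) * q Z 0 j)"
  proof -
    have "(\<Sum>i=1..n. y $ (n + i) * (if i < n then q Z 0 (i + 1) else 0))
        = (\<Sum>i\<in>{1..<n}. y $ (n + i) * q Z 0 (i + 1))"
      by (rule sum.mono_neutral_cong_right) auto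
    \<comment> \<open>Shift \<open>j = i + 1\<close>: the weight of \<open>G n D (j - 1)\<close>
      sits at position \<open>n + j - 1\<close> of \<open>y\<close>.\<close>
    also have "\<dots> = (\<Sum>j\<in>{2..n}. y $ (n + j - 1) * q Z 0 j)"
      by (rule sum.reindex_bij_witness[of _ "\<lambda>j. j - 1" Suc]) auto
    also have "\<dots> = (\<Sum>j=1..n. (if 2 \<le> j then y $ (n + j - 1) else 0) * q Z 0 j)"
      by (rule sum.mono_neutral_cong_left) auto
    finally show ?thesis .
  qed
  also have "(\<Sum>k=1..n. y $ k * ?S $ k)
      = (\<Sum>k=1..n. y $ k * Z $$ (k, k)) - (\<Sum>k=1..n. y $ k * Z $$ (0, k))"
    unfolding sum_subtractf[symmetric]
    by (intro sum.cong refl) (auto simp: shor_map_def algebra_simps)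
  also have "(\<Sum>k=1..n. y $ k * Z $$ (0, k)) = (\<Sum>j=1..n. moment y j * q Z 0 j)"
  proof -
    have "(\<Sum>k=1..n. y $ k * Z $$ (0, k)) = (\<Sum>k=1..n. \<Sum>j=1..n. y $ k * t k ^ j * q Z 0 j)"
      by (intro sum.cong refl) (simp add: row0_entry sum_distrib_left mult.assoc)
    also have "\<dots> = (\<Sum>j=1..n. moment y j * q Z 0 j)"
      unfolding moment_def sum_distrib_right by (rule sum.swap)
    finally show ?thesis .
  qed
  also have "(\<Sum>k=1..n. y $ k * Z $$ (k, k))
      = (\<Sum>i=1..n. \<Sum>j=1..n. moment y (i + j) * q Z i j)"
  proof -
    have "(\<Sum>k=1..n. y $ k * Z $$ (k, k))
        = (\<Sum>k=1..n. \<Sum>i=1..n. \<Sum>j=1..n. y $ k * t k ^ (i + j) * q Z i j)"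
      by (intro sum.cong refl) (simp add: diag_entry sum_distrib_left mult.assoc)
    also have "\<dots> = (\<Sum>i=1..n. \<Sum>k=1..n. \<Sum>j=1..n. y $ k * t k ^ (i + j) * q Z i j)"
      by (rule sum.swap)
    also have "\<dots> = (\<Sum>i=1..n. \<Sum>j=1..n. moment y (i + j) * q Z i j)"
      unfolding moment_def sum_distrib_right by (intro sum.cong refl sum.swap)
    finally show ?thesis .
  qed
  finally show ?thesis
    by (simp add: Hess_def lin_def distrib_right sum.distrib)
qed

text \<open>The quadratic form at \<open>s e_i + e_j\<close>, as a polynomial in \<open>s\<close>.
  The case \<open>i = j\<close> is included and is used below with \<open>s = 0\<close>.\<close>

lemma sum_two_points:
  fixes H :: "nat \<Rightarrow> nat \<Rightarrow> real" and s :: real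
  assumes "finite A" "i \<in> A" "j \<in> A"
  defines "b \<equiv> \<lambda>k. s * of_bool (k = i) + of_bool (k = j)"
  shows "(\<Sum>k\<in>A. \<Sum>l\<in>A. H k l * (b k * b l)) = s\<^sup>2 * H i i + s * (H i j + H j i) + H j j"
proof -
  have one: "(\<Sum>k\<in>A. f k * b k) = s * f i + f j" for f :: "nat \<Rightarrow> real"
  proof -
    have "(\<Sum>k\<in>A. f k * b k) = (\<Sum>k\<in>A. if k = i then s * f k else 0) + (\<Sum>k\<in>A. if k = j then f k else 0)"
      unfolding sum.distrib[symmetric] by (intro sum.cong) (auto simp: b_def algebra_simps)
    with assms show ?thesis by simp
  qed
  have "(\<Sum>k\<in>A. \<Sum>l\<in>A. H k l * (b k * b l)) = (\<Sum>k\<in>A. (\<Sum>l\<in>A. H k l * b l) * b k)"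
    by (simp add: sum_distrib_left mult_ac)
  also have "\<dots> = s\<^sup>2 * H i i + s * (H i j + H j i) + H j j"
    unfolding one by (simp add: power2_eq_square algebra_simps)
  finally show ?thesis .
qed

lemma Hess_sym: "Hess y i j = Hess y j i"
  by (simp add: Hess_def add.commute)

section \<open>Functionals nonnegative on a face\<close>

lemma functional_rank1:
  assumes y: "y \<in> carrier_vec (2 * n + 1)" "y $ 0 = 0"
  shows "y \<bullet> shor_map n D (rank1 b)
    = (\<Sum>i=1..n. \<Sum>j=1..n. Hess y i j * (b i * b j)) - (\<Sum>j=1..n. lin y j * (b 0 * b j))"
  by (simp add: functional_eq[OF y psd_cone_sym[OF rank1_psd]] q_rank1)

text \<open>Rank-one test matrices supported on \<open>0..m\<close> turn the hypothesis into
  polynomials in \<open>s\<close> that are nonnegative everywhere. The coefficients shown to be zero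
  cover every coordinate that can be nonzero on \<open>face (m - 1)\<close>.\<close>

lemma functional_vanishes:
  assumes y: "y \<in> carrier_vec (2 * n + 1)" "y $ 0 = 0"
    and m: "1 \<le> m" "m \<le> n"
    and nonneg: "\<And>Z. Z \<in> face m \<Longrightarrow> y \<bullet> shor_map n D Z \<ge> 0"
    and Z: "Z \<in> face (m - 1)"
  shows "y \<bullet> shor_map n D Z = 0"
proof -
  have rank1: "(\<Sum>i=1..n. \<Sum>j=1..n. Hess y i j * (b i * b j)) - (\<Sum>j=1..n. lin y j * (b 0 * b j)) \<ge> 0"
    if "\<And>i. m < i \<Longrightarrow> b i = 0" for b
    using nonneg[of "rank1 b"] that by (simp add: functional_rank1[OF y] rank1_face_iff)
  have lin0: "lin y j = 0" if j: "1 \<le> j" "j \<le> m" for j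
  proof -
    have "Hess y j j + s * (- lin y j) + s\<^sup>2 * 0 \<ge> 0" for s
    proof -
      \<comment> \<open>The test vector \<open>s e_0 + e_j\<close>: no \<open>s^2\<close> term
        arises because the functional has no \<open>(0, 0)\<close> entry.\<close>
      define b where "b k = (if k = 0 then s else of_bool (k = j))" for k
      have "(\<Sum>i=1..n. \<Sum>l=1..n. Hess y i l * (b i * b l)) = Hess y j j"
      proof -
        have "(\<Sum>i=1..n. \<Sum>l=1..n. Hess y i l * (b i * b l))
          = (\<Sum>i=1..n. \<Sum>l=1..n. Hess y i l
              * ((0 * of_bool (i = j) + of_bool (i = j)) * (0 * of_bool (l = j) + of_bool (l = j))))"
          by (intro sum.cong refl) (simp add: b_def)
        also have "\<dots> = Hess y j j"
          using j m by (subst sum_two_points) auto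
        finally show ?thesis .
      qed
      moreover have "(\<Sum>l=1..n. lin y l * (b 0 * b l)) = s * lin y j"
      proof -
        have "(\<Sum>l=1..n. lin y l * (b 0 * b l)) = (\<Sum>l=1..n. if l = j then s * lin y l else 0)"
          by (intro sum.cong refl) (auto simp: b_def)
        with j m show ?thesis by simp
      qed
      ultimately show ?thesis
        using rank1[of b] j by (simp add: b_def)
    qed
    from quadratic_nonneg_zero[OF this] show ?thesis by simp
  qed
  \<comment> \<open>As for a semidefinite matrix, a zero diagonal entry clears its row within the
    block \<open>1..m\<close>.\<close>
  have Hess_row: "Hess y i j = 0" if "1 \<le> i" "i \<le> m" "1 \<le> j" "j \<le> m" "Hess y i i = 0" for i j
  proof -
    have "Hess y j j + s * (2 * Hess y i j) + s\<^sup>2 * Hess y i i \<ge> 0" for s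
    proof -
      define b where "b k = s * of_bool (k = i) + of_bool (k = j)" for k
      have "(\<Sum>k=1..n. \<Sum>l=1..n. Hess y k l * (b k * b l))
          = s\<^sup>2 * Hess y i i + s * (Hess y i j + Hess y j i) + Hess y j j"
        unfolding b_def using that m by (intro sum_two_points) auto
      moreover have "b 0 = 0" "\<And>k. m < k \<Longrightarrow> b k = 0"
        using that by (auto simp: b_def)
      ultimately show ?thesis
        using rank1[of b] Hess_sym[of y j i] by (simp add: algebra_simps)
    qed
    from quadratic_nonneg_zero[OF this that(5)] show ?thesis by simp
  qed
  have Hess_diag: "Hess y i i = 0" if "1 \<le> i" "i < m" for i
    using that
  proof (induction i rule: less_induct)
    case (less i)
    \<comment> \<open>\<open>i < m\<close> puts \<open>i + 1\<close> in the range of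
      \<open>lin0\<close>; position \<open>n + (i + 1) - 1\<close> holds the weight of
      \<open>G n D i\<close>.\<close>
    have lin: "moment y (i + 1) + y $ (n + i) = 0"
      using lin0[of "i + 1"] less.prems by (simp add: lin_def)
    show ?case
    proof (cases "i = 1")
      case True
      \<comment> \<open>Here \<open>i + 1 = i + i\<close>, so \<open>lin\<close> already is the
        diagonal entry.\<close>
      with lin show ?thesis by (simp add: Hess_def)
    next
      case False
      with less.prems have i: "1 \<le> i - 1" "i - 1 < i" "i - 1 < m" "1 < i" "1 < m"
        "i - 1 \<le> m" "i \<le> m" "1 \<le> i + 1" "i + 1 \<le> m" "1 \<le> m" "1 \<le> i" by linarith+
      \<comment> \<open>This off-diagonal entry has moment index \<open>i + i\<close> and lies in
        the cleared row \<open>i - 1\<close>.\<close>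
      have "Hess y (i - 1) (i + 1) = 0"
        by (rule Hess_row[OF i(1,6,8,9) less.IH[OF i(2,1,3)]])
      moreover have "i - 1 \<noteq> i + 1" "i - 1 + (i + 1) = i + i"
        using i(1) by linarith+
      ultimately have "moment y (i + i) = 0"
        by (simp only: Hess_def if_False add_0_right)
      \<comment> \<open>Off the diagonal since \<open>i > 1\<close>, this entry has moment index
        \<open>i + 1\<close>; its vanishing reduces \<open>lin\<close> to
        \<open>y $ (n + i) = 0\<close>.\<close>
      have "Hess y 1 i = 0"
        by (rule Hess_row[OF order_refl i(10,11,7) less.IH[OF i(4) order_refl i(5)]])
      then have "moment y (i + 1) = 0"
        using i by (simp add: Hess_def)
      with lin \<open>moment y (i + i) = 0\<close> show ?thesis by (simp add: Hess_def)
    qed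
  qed
  have HZ: "Hess y i j * q Z i j = 0" if "1 \<le> i" "i \<le> n" "1 \<le> j" "j \<le> n" for i j
  proof (cases "i < m \<and> j < m")
    case True
    with that show ?thesis by (simp add: Hess_row Hess_diag)
  next
    case False
    then have "m - 1 < i \<or> m - 1 < j" using m by linarith
    with that show ?thesis
      using face_q_zero[OF Z] by auto
  qed
  have LZ: "lin y j * q Z 0 j = 0" if "1 \<le> j" "j \<le> n" for j
    using that lin0[of j] face_q_zero(2)[OF Z, of j 0] by (cases "j < m") auto
  have "(\<Sum>i=1..n. \<Sum>j=1..n. Hess y i j * q Z i j) = 0"
    by (intro sum.neutral ballI) (simp only: HZ atLeastAtMost_iff)
  moreover have "(\<Sum>j=1..n. lin y j * q Z 0 j) = 0"
    by (intro sum.neutral ballI) (simp only: LZ atLeastAtMost_iff)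
  ultimately show ?thesis
    by (simp only: functional_eq[OF y face_sym[OF Z]])
qed

section \<open>The minimal face and the singularity degree\<close>

lemma S_set_eq_feasible: "S_set n D = feasible_set (Suc n) (shor_map n D) (shor_rhs n)"
proof -
  have "(Y $$ (0, 0) = 1 \<and> (\<forall>k\<in>{1..n}. Y $$ (k, k) - Y $$ (0, k) = 0)
      \<and> (\<forall>i\<in>{1..n}. mat_inner (G n D i) Y = 0)) \<longleftrightarrow> shor_map n D Y = shor_rhs n" (is "?L \<longleftrightarrow> ?R") for Y
  proof
    assume L: ?L
    show ?R
    proof (rule eq_vecI)
      fix j assume "j < dim_vec (shor_rhs n)"
      then have j: "j < 2 * n + 1" by (simp add: shor_rhs_def)
      then have "n < j \<Longrightarrow> j - n \<in> {1..n}" by auto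
      with L j show "shor_map n D Y $ j = shor_rhs n $ j"
        by (auto simp: shor_map_def shor_rhs_def)
    qed (simp add: shor_map_def shor_rhs_def)
  next
    assume R: ?R
    have 0: "shor_map n D Y $ j = (if j = 0 then 1 else 0)" if "j < 2 * n + 1" for j
      unfolding R using that by (simp add: shor_rhs_def)
    have "Y $$ (0, 0) = 1"
      using 0[of 0] by (simp add: shor_map_def)
    moreover have "Y $$ (k, k) - Y $$ (0, k) = 0" if "k \<in> {1..n}" for k
      using 0[of k] that by (simp add: shor_map_def)
    moreover have "mat_inner (G n D i) Y = 0" if "i \<in> {1..n}" for i
      using 0[of "n + i"] that by (simp add: shor_map_def)
    ultimately show ?L by blast
  qed
  then show ?thesis
    by (simp add: S_set_def feasible_set_def)
qed

text \<open>The matrix \<open>e\<^sub>0e\<^sub>0\<^sup>T\<close>, the only feasible point.\<close>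

definition E :: "real mat" where
  "E = rank1 (\<lambda>k. of_bool (k = 0))"

lemma q_E: "\<lbrakk>i \<le> n; j \<le> n\<rbrakk> \<Longrightarrow> q E i j = of_bool (i = 0 \<and> j = 0)"
  by (simp add: E_def q_rank1)

lemma E_in_S_set: "E \<in> S_set n D"
proof -
  have E: "E \<in> psd_cone (Suc n)" by (simp add: E_def rank1_psd)
  have entry: "E $$ (k, l) = P k 0 * P l 0" if "k \<le> n" "l \<le> n" for k l
    using that by (simp add: E_def rank1_def sum_atMost_split)
  have "mat_inner (G n D i) E = 0" if "i \<in> {1..n}" for i
    using that by (simp add: inner_G[OF psd_cone_sym[OF E]] q_E)
  then show ?thesis
    using E by (simp add: S_set_def entry P_def)
qed

text \<open>For \<open>m < n\<close> the subtracted term \<open>q Z 0 (m + 1)\<close> lies in a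
  column that vanishes on \<open>face m\<close>.\<close>

lemma inner_G_face:
  assumes "Z \<in> face m" "1 \<le> m" "m \<le> n"
  shows "mat_inner (G n D m) Z = q Z m m"
  using assms face_q_zero(2)[of Z m "m + 1" 0] by (simp add: inner_G face_sym)

lemma face_pred:
  assumes "1 \<le> m" "m \<le> n"
  shows "face (m - 1) = {Z \<in> face m. q Z m m = 0}"
proof -
  have "m - 1 < i \<longleftrightarrow> m < i \<or> i = m" for i using assms by linarith
  with assms show ?thesis by (auto simp: face_def)
qed

text \<open>Induction down from \<open>face n\<close>: once the coordinates above \<open>m\<close>
  vanish, \<open>inner_G_face\<close> turns the equation for \<open>G n D m\<close> into
  \<open>q Z m m = 0\<close>. This reaches \<open>face 0\<close>, which lies in every
  \<open>face m\<close>.\<close>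

lemma S_set_subset_face: "S_set n D \<subseteq> face m"
proof -
  have "S_set n D \<subseteq> face (n - k)" for k
  proof (induction k)
    case 0
    then show ?case by (auto simp: S_set_def face_n)
  next
    case (Suc k)
    show ?case
    proof (cases "k < n")
      case True
      then have m: "1 \<le> n - k" "n - k \<le> n" by auto
      show ?thesis
      proof
        fix Z assume Z: "Z \<in> S_set n D"
        with Suc have "Z \<in> face (n - k)" by blast
        moreover from Z m have "mat_inner (G n D (n - k)) Z = 0" by (simp add: S_set_def)
        ultimately have "Z \<in> face (n - k - 1)"
          unfolding face_pred[OF m] using inner_G_face[OF _ m] by simp
        then show "Z \<in> face (n - Suc k)" by simp
      qed
    next
      case False
      with Suc show ?thesis by simp
    qed
  qed
  from this[of n] have "S_set n D \<subseteq> face 0" by simp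
  then show ?thesis by (auto simp: face_def)
qed

lemma face_0_eq: "Y \<in> face 0 \<Longrightarrow> Y = q Y 0 0 \<cdot>\<^sub>m E"
proof (rule mat_eqI_q)
  assume Y: "Y \<in> face 0"
  show "Y \<in> carrier_mat (Suc n) (Suc n)"
    using Y by (intro sym_mats_carrier face_sym)
  show "q Y 0 0 \<cdot>\<^sub>m E \<in> carrier_mat (Suc n) (Suc n)"
    by (simp add: E_def rank1_carrier)
  fix i j assume ij: "i \<le> n" "j \<le> n"
  have "q (q Y 0 0 \<cdot>\<^sub>m E) i j = q Y 0 0 * q E i j"
    by (simp add: q_smult E_def rank1_carrier)
  also have "\<dots> = q Y i j"
    using ij face_q_zero[OF Y] by (auto simp: q_E)
  finally show "q Y i j = q (q Y 0 0 \<cdot>\<^sub>m E) i j" by simp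
qed

text \<open>\<open>face 0\<close> is the ray through the feasible matrix \<open>E\<close>. A face
  containing \<open>E\<close> contains the ends of every segment of the cone through whose inside
  \<open>E\<close> passes, hence by convexity the whole ray.\<close>

lemma minimal_face_eq: "minimal_face (Suc n) (shor_map n D) (shor_rhs n) = face 0"
proof -
  have "face 0 \<subseteq> F" if F: "is_face F (psd_cone (Suc n))" and S: "S_set n D \<subseteq> F" for F
  proof
    fix Y assume Y: "Y \<in> face 0"
    define c where "c = q Y 0 0"
    have c: "c \<ge> 0" using Y by (simp add: c_def q_nonneg face_psd)
    have E: "E \<in> carrier_mat (Suc n) (Suc n)" by (simp add: E_def rank1_carrier)
    have EF: "E \<in> F" using S E_in_S_set by blast
    have scale: "s \<cdot>\<^sub>m E \<in> psd_cone (Suc n)" if "s \<ge> 0" for s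
    proof -
      have "s \<cdot>\<^sub>m E = rank1 (\<lambda>k. sqrt s * of_bool (k = 0))"
        using that by (intro mat_eqI_q) (auto simp: E rank1_carrier q_rank1 q_smult q_E)
      then show ?thesis by (simp add: rank1_psd)
    qed
    \<comment> \<open>\<open>E\<close> lies strictly between 0 and \<open>(c + 2) E\<close>; the
      summand 2 keeps \<open>u < 1\<close> even for \<open>c = 0\<close>.\<close>
    have "E = (1 - u) \<cdot>\<^sub>m (0 \<cdot>\<^sub>m E) + u \<cdot>\<^sub>m ((c + 2) \<cdot>\<^sub>m E)" if "u = 1 / (c + 2)" for u
      using E that c by (intro eq_matI) auto
    moreover define u where "u = 1 / (c + 2)"
    moreover have "0 < u" "u < 1" using c by (auto simp: u_def field_simps)
    ultimately have mem: "0 \<cdot>\<^sub>m E \<in> F" "(c + 2) \<cdot>\<^sub>m E \<in> F"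
      using F EF scale[of 0] scale[of "c + 2"] c unfolding is_face_def by (metis add_nonneg_nonneg order_refl zero_le_numeral)+
    have "c \<cdot>\<^sub>m E = (1 - c / (c + 2)) \<cdot>\<^sub>m (0 \<cdot>\<^sub>m E) + (c / (c + 2)) \<cdot>\<^sub>m ((c + 2) \<cdot>\<^sub>m E)"
      using E c by (intro eq_matI) auto
    also have "\<dots> \<in> F"
    proof -
      have "convex_mats F" using F by (simp add: is_face_def)
      moreover have "0 \<le> c / (c + 2) \<and> c / (c + 2) \<le> 1" using c by simp
      ultimately show ?thesis using mem unfolding convex_mats_def by blast
    qed
    finally show "Y \<in> F" using face_0_eq[OF Y] by (simp add: c_def)
  qed
  then show ?thesis
    unfolding minimal_face_def S_set_eq_feasible[symmetric]
    using is_face_face S_set_subset_face by blast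
qed

section \<open>Upper and lower bounds on the number of reduction steps\<close>

abbreviation reduction_step :: "real mat set \<Rightarrow> real mat set \<Rightarrow> bool" where
  "reduction_step \<equiv> facial_reduction_step (Suc n) (2 * n + 1) (shor_map n D) (shor_rhs n)"

lemma rhs_scalar_prod: "y \<in> carrier_vec (2 * n + 1) \<Longrightarrow> shor_rhs n \<bullet> y = y $ 0"
  by (simp add: shor_rhs_def)

lemma reduction_step_face:
  assumes m: "1 \<le> m" "m \<le> n"
  shows "reduction_step (face m) (face (m - 1))"
proof -
  \<comment> \<open>Components of \<open>shor_map\<close> beyond \<open>n\<close> belong to the
    \<open>G\<close> equations, so position \<open>n + m\<close> selects
    \<open>G n D m\<close>.\<close>
  define y :: "real vec" where "y = unit_vec (2 * n + 1) (n + m)"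
  have y: "y \<in> carrier_vec (2 * n + 1)" by (simp add: y_def)
  have rhs: "shor_rhs n \<bullet> y = 0"
    unfolding rhs_scalar_prod[OF y] using m by (simp add: y_def)
  have inner: "mat_inner (adjoint_map (Suc n) (shor_map n D) y) Z = q Z m m" if "Z \<in> face m" for Z
  proof -
    have "mat_inner (adjoint_map (Suc n) (shor_map n D) y) Z = shor_map n D Z $ (n + m)"
      using that m by (subst inner_adjoint_shor_map[OF y face_sym])
        (auto simp: y_def shor_map_def intro!: scalar_prod_left_unit)
    also have "\<dots> = q Z m m"
      using m that by (simp add: shor_map_def inner_G_face)
    finally show ?thesis .
  qed
  \<comment> \<open>A witness that the functional is not identically zero on
    \<open>face m\<close>.\<close>
  let ?R = "rank1 (\<lambda>k. of_bool (k = m))"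
  have R: "?R \<in> face m" "q ?R m m = 1"
    using m by (auto simp: rank1_face_iff q_rank1)
  have "\<exists>Z\<in>face m. mat_inner (adjoint_map (Suc n) (shor_map n D) y) Z \<noteq> 0"
    using R by (intro bexI[of _ ?R]) (simp_all add: inner)
  moreover have "\<forall>Z\<in>face m. mat_inner (adjoint_map (Suc n) (shor_map n D) y) Z \<ge> 0"
    by (simp add: inner q_nonneg face_psd)
  moreover have "face (m - 1) = {Z \<in> face m. mat_inner (adjoint_map (Suc n) (shor_map n D) y) Z = 0}"
    unfolding face_pred[OF m] using inner by auto
  ultimately show ?thesis
    unfolding facial_reduction_step_def S_set_eq_feasible[symmetric]
    using is_face_face S_set_subset_face y rhs by blast
qed

text \<open>\<open>F\<close> may be any face containing \<open>face m\<close>: nonnegativity on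
  \<open>F\<close> restricts to \<open>face m\<close>, so \<open>functional_vanishes\<close> keeps
  all of \<open>face (m - 1)\<close>. This invariant drives the lower bound.\<close>

lemma reduction_step_subset:
  assumes step: "reduction_step F F'" and sub: "face m \<subseteq> F" and m: "1 \<le> m" "m \<le> n"
  shows "face (m - 1) \<subseteq> F'"
proof -
  let ?w = "\<lambda>y. adjoint_map (Suc n) (shor_map n D) y"
  obtain y where y: "y \<in> carrier_vec (2 * n + 1)" "shor_rhs n \<bullet> y = 0"
    and nonneg: "\<forall>Z\<in>F. mat_inner (?w y) Z \<ge> 0"
    and F': "F' = {Z \<in> F. mat_inner (?w y) Z = 0}"
    using step unfolding facial_reduction_step_def by blast
  have y0: "y $ 0 = 0" using y rhs_scalar_prod by simp
  have inner: "mat_inner (?w y) Z = y \<bullet> shor_map n D Z" if "Z \<in> face k" for Z k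
    by (rule inner_adjoint_shor_map[OF y(1) face_sym[OF that]])
  have pos: "y \<bullet> shor_map n D Z \<ge> 0" if "Z \<in> face m" for Z
    using nonneg sub that inner[OF that] by (metis subsetD)
  have "face (m - 1) \<subseteq> face m"
    unfolding face_pred[OF m] by blast
  with sub show ?thesis
    using functional_vanishes[OF y(1) y0 m pos] inner unfolding F' by auto
qed

lemma reduction_steps_face: "s \<le> n \<Longrightarrow> (reduction_step ^^ s) (psd_cone (Suc n)) (face (n - s))"
proof (induction s)
  case 0
  then show ?case by (simp add: face_n)
next
  case (Suc s)
  then have "reduction_step (face (n - s)) (face (n - s - 1))"
    by (intro reduction_step_face) auto
  with Suc show ?case by (auto intro: relcomppI)
qed

lemma reduction_steps_subset:
  "\<lbrakk>(reduction_step ^^ s) (psd_cone (Suc n)) F; s \<le> n\<rbrakk> \<Longrightarrow> face (n - s) \<subseteq> F"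
proof (induction s arbitrary: F)
  case 0
  then show ?case by (simp add: face_n)
next
  case (Suc s)
  then obtain F0 where F0: "(reduction_step ^^ s) (psd_cone (Suc n)) F0" "reduction_step F0 F"
    by auto
  have "face (n - s - 1) \<subseteq> F"
    using Suc.IH[OF F0(1)] Suc.prems F0(2) by (intro reduction_step_subset[of F0]) auto
  then show ?case by simp
qed

lemma singularity_degree_eq:
  "singularity_degree (Suc n) (2 * n + 1) (shor_map n D) (shor_rhs n) = enat n"
  unfolding singularity_degree_def minimal_face_eq
proof (rule antisym)
  have "(reduction_step ^^ n) (psd_cone (Suc n)) (face 0)"
    using reduction_steps_face[of n] by simp
  then show "Inf {enat s |s. (reduction_step ^^ s) (psd_cone (Suc n)) (face 0)} \<le> enat n"
    by (intro Inf_lower) blast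
  have "n \<le> s" if s: "(reduction_step ^^ s) (psd_cone (Suc n)) (face 0)" for s
  proof (rule ccontr)
    assume "\<not> n \<le> s"
    with reduction_steps_subset[OF s] have sub: "face (n - s) \<subseteq> face 0" and "1 \<le> n - s" by auto
    \<comment> \<open>Coordinate 1 is still free in \<open>face (n - s)\<close>, so this matrix
      separates it from \<open>face 0\<close>.\<close>
    have "rank1 (\<lambda>k. of_bool (k = 1)) \<in> face (n - s)"
      using \<open>1 \<le> n - s\<close> by (auto simp: rank1_face_iff)
    with sub have "rank1 (\<lambda>k. of_bool (k = 1)) \<in> face 0" by blast
    with n_pos show False by (auto simp: rank1_face_iff)
  qed
  then show "enat n \<le> Inf {enat s |s. (reduction_step ^^ s) (psd_cone (Suc n)) (face 0)}"
    by (intro Inf_greatest) auto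
qed

section \<open>The solution set of the binary system\<close>

lemma ell_eq_0:
  assumes "x \<in> X_set n D" "1 \<le> i" "i \<le> n"
  shows "ell D i x = 0"
  using assms(3, 2)
\<comment> \<open>Downward from \<open>n\<close>: once \<open>ell D (i + 1) x = 0\<close>, the
  \<open>i\<close>th equation says that \<open>ell D i x\<close> squares to 0.\<close>
proof (induction i rule: inc_induct)
  case base
  with assms show ?case by (simp add: X_set_def)
next
  case (step i)
  then have "(ell D i x)\<^sup>2 - ell D (i + 1) x = 0"
    using assms(1) by (simp add: X_set_def)
  with step show ?case by simp
qed

lemma X_set_eq: "X_set n D = {0\<^sub>v n}"
proof
  have "ell D i (0\<^sub>v n) = 0" for i
    using D_carrier by (simp add: ell_def d_row_def scalar_prod_def)
  then show "{0\<^sub>v n} \<subseteq> X_set n D"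
    by (simp add: X_set_def)
  show "X_set n D \<subseteq> {0\<^sub>v n}"
  proof
    let ?C = "mat n n (\<lambda>(i, j). t (i + 1) ^ (j + 1))"
    fix x assume x: "x \<in> X_set n D"
    then have xc: "x \<in> carrier_vec n" by (simp add: X_set_def)
    have "D *\<^sub>v x = 0\<^sub>v n"
    proof (rule eq_vecI)
      fix i assume "i < dim_vec (0\<^sub>v n)"
      then show "(D *\<^sub>v x) $ i = 0\<^sub>v n $ i"
        using D_carrier ell_eq_0[OF x, of "i + 1"] by (simp add: ell_def d_row_def)
    qed (use D_carrier in auto)
    \<comment> \<open>Multiplying by the inverse of \<open>D\<close> recovers \<open>x\<close> from
      its vanishing linear forms.\<close>
    then have "?C *\<^sub>v (D *\<^sub>v x) = 0\<^sub>v n" by auto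
    then have "(?C * D) *\<^sub>v x = 0\<^sub>v n"
      using assoc_mult_mat_vec[of ?C n n D n x] D_carrier xc by simp
    then show "x \<in> {0\<^sub>v n}"
      unfolding C_D using xc by simp
  qed
qed

end

section \<open>Invertibility of the Vandermonde matrix\<close>

text \<open>A nonzero kernel vector would be the coefficient list of a nonzero polynomial of degree
  at most \<open>n - 1\<close> with the \<open>n\<close> distinct roots
  \<open>t 1, ..., t n\<close>.\<close>

lemma vandermonde_det_nonzero:
  fixes t :: "nat \<Rightarrow> real"
  assumes pos: "\<forall>i\<in>{1..n}. t i > 0" and inj: "inj_on t {1..n}"
  shows "det (mat n n (\<lambda>(i, j). t (i + 1) ^ (j + 1))) \<noteq> 0"
proof
  let ?C = "mat n n (\<lambda>(i, j). t (i + 1) ^ (j + 1))"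
  assume "det ?C = 0"
  then obtain v where v: "v \<in> carrier_vec n" "v \<noteq> 0\<^sub>v n" "?C *\<^sub>v v = 0\<^sub>v n"
    using det_0_iff_vec_prod_zero[of ?C n] by auto
  define p where "p = (\<Sum>j<n. monom (v $ j) j)"
  have coeff: "coeff p j = (if j < n then v $ j else 0)" for j
    by (simp add: p_def coeff_sum)
  have root: "poly p (t (i + 1)) = 0" if i: "i < n" for i
  proof -
    \<comment> \<open>Exponents in the matrix start at 1, hence the extra factor
      \<open>t (i + 1)\<close>, which positivity cancels below.\<close>
    have "t (i + 1) * poly p (t (i + 1)) = (\<Sum>j<n. t (i + 1) ^ (j + 1) * v $ j)"
      by (simp add: p_def poly_sum poly_monom sum_distrib_left mult_ac)
    also have "\<dots> = (?C *\<^sub>v v) $ i"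
      using i v(1) by (simp add: scalar_prod_def lessThan_atLeast0)
    also have "\<dots> = 0" unfolding v(3) using i by simp
    finally have "t (i + 1) * poly p (t (i + 1)) = 0" .
    moreover have "t (i + 1) > 0" using pos i by simp
    ultimately show ?thesis by simp
  qed
  have roots: "t ` {1..n} \<subseteq> {x. poly p x = 0}"
  proof
    fix x assume "x \<in> t ` {1..n}"
    then obtain i where "x = t i" "1 \<le> i" "i \<le> n" by auto
    with root[of "i - 1"] show "x \<in> {x. poly p x = 0}" by simp
  qed
  obtain j where j: "j < n" "v $ j \<noteq> 0"
    using v(1,2) by (metis carrier_vecD eq_vecI index_zero_vec)
  then have p0: "p \<noteq> 0" using coeff[of j] by auto
  have "degree p \<le> n - 1"
    by (rule degree_le) (auto simp: coeff)
  moreover have "n \<le> card {x. poly p x = 0}"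
    using card_mono[OF poly_roots_finite[OF p0] roots] card_image[OF inj] by simp
  moreover have "card {x. poly p x = 0} \<le> degree p"
    by (rule card_poly_roots_bound[OF p0])
  ultimately show False using j by linarith
qed

theorem theorem4p1:
  fixes n :: nat and t :: "nat \<Rightarrow> real" and C D :: "real mat"
  assumes "n \<ge> 1"
    and "\<forall>i\<in>{1..n}. t i > 0"
    and "inj_on t {1..n}"
    and "C = mat n n (\<lambda>(i, j). t (i + 1) ^ (j + 1))"
    and "D = the (mat_inverse C)"
  shows "invertible_mat C
    \<and> X_set n D = {0\<^sub>v n}
    \<and> S_set n D = feasible_set (n + 1) (shor_map n D) (shor_rhs n)
    \<and> singularity_degree (n + 1) (2 * n + 1) (shor_map n D) (shor_rhs n) = enat n"
proof -
  have C: "C \<in> carrier_mat n n" by (simp add: assms(4))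
  have "det C \<noteq> 0"
    unfolding assms(4) by (rule vandermonde_det_nonzero[OF assms(2,3)])
  \<comment> \<open>\<open>mat_inverse\<close> returns an option; excluding \<open>None\<close>
    makes \<open>the\<close> yield the actual inverse.\<close>
  then have "mat_inverse C \<noteq> None"
    using det_non_zero_imp_unit[OF C, where b = "()"] mat_inverse(1)[OF C, where b = "()"] by blast
  then have D: "C * D = 1\<^sub>m n" "D * C = 1\<^sub>m n" "D \<in> carrier_mat n n"
    using mat_inverse(2)[OF C] assms(5) by auto
  interpret shor_system n t D
    using assms(1) D by unfold_locales (simp_all add: assms(4))
  have "invertible_mat C"
    using C D by (auto simp: invertible_mat_def inverts_mat_def intro!: exI[of _ D])
  then show ?thesis
    using X_set_eq S_set_eq_feasible singularity_degree_eq by simp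
qed

end
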